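(* Let $A$ be a real $m\times n$ matrix, let $1\le s\le m$ be an integer, let $\{1,\dots,n\}$ be partitioned into disjoint sets $P_+$ and $P_n$, and let $\|\cdot\|$ be a norm on $\mathbb{R}^m$. Let $w\in\mathbb{R}^n$ with $w_i\ge 0$ for all $i\in P_+$ be such that $\|w-w^s\|_1\le\mu$, where $w^s$ is the vector obtained from $w$ by replacing all but the $s$ largest in magnitude entries in $w$ with zeros. Let $y\in\mathbb{R}^m$ be such that $\|Aw-y\|\le\varepsilon$, and let, finally, $x\in\mathbb{R}^n$ be an approximate solution to the optimization problem $$\mathrm{Opt}=\min_z\{\|z\|_1:\ \|Az-y\|\le\varepsilon,\ z_i\ge 0\ \ \forall i\in P_+\}$$ such that $\|x\|_1\le\mathrm{Opt}+\nu$ and $\|Ax-y\|\le\delta$. 1. If $A$ satisfies the condition $\mathbf{SG}_{s,\beta}(\xi,\theta)$ with some $\xi\in(0,1)$, $\beta\in[0,\infty)$ and $\theta\in[1,\infty)$, then $$\|x-w\|_1\le\frac{1+\xi}{1-\xi}\nu+\frac{2(1+\xi\theta)}{1-\xi}\mu+\frac{2\beta}{1-\xi}(\varepsilon+\delta).$$ 2. If $A$ satisfies the condition $\mathbf{SG}_{s,\beta}(\xi)$ with some $\xi\in(0,1)$ and $\beta\in[0,\infty)$, then $$\|x-w\|_1\le\frac{1+\xi}{1-\xi}\nu+\frac{2(1+\beta\alpha)}{1-\xi}\mu+\frac{2\beta}{1-\xi}(\varepsilon+\delta),$$ where $\alpha$ stands for the maximum of the $\|\cdot\|$-norms of the columns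 of $A$.
   Context: Definitions (with respect to $s$, $P_+$, $P_n$ and the norm $\|\cdot\|$ on $\mathbb{R}^m$). Condition $\mathbf{SG}_{s,\beta}(\xi,\theta)$: for every $x\in\mathbb{R}^n$ and every subset $J$ of $\{1,\dots,n\}$ with $\mathrm{Card}(J)\le s$, $$\sum_{i\in J\cap P_+}x_i+\sum_{i\in J\cap P_n}|x_i|\le\beta\|Ax\|+\xi\Big(\sum_{i\in P_n\setminus J}|x_i|+\sum_{i\in P_+\setminus J}\max[-x_i,\theta x_i]\Big).$$ Condition $\mathbf{SG}_{s,\beta}(\xi)$: for every $J\subset\{1,\dots,n\}$ with $\mathrm{Card}(J)\le s$ and every $x\in\mathbb{R}^n$ such that $x_i\le 0$ for all $i\in P_+\setminus J$, $$\sum_{i\in J\cap P_+}x_i+\sum_{i\in J\cap P_n}|x_i|\le\beta\|Ax\|+\xi\sum_{i\notin J}|x_i|.$$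
   Formalization: The approximate solution x is required to satisfy the sign constraints x_i ≥ 0 for i in P_+; without this the claim fails, e.g. A=[1,-1], P_+={1,2}, s=β=1, ξ=1/2, θ=2, w=(1,0), y=1, x=(0,-1), μ=ν=ε=δ=0. *)

theory Defs
  imports "HOL-Analysis.Analysis"
begin

text \<open>
  The type \<open>real ^ 'm\<close> carries the Euclidean norm; the results concern an arbitrary norm,
  which is therefore passed around as an explicit function \<open>N\<close>.
\<close>

definition is_norm :: "('v::real_vector \<Rightarrow> real) \<Rightarrow> bool" where
  "is_norm N \<longleftrightarrow>
     (\<forall>u. 0 \<le> N u) \<and>
     (\<forall>u. N u = 0 \<longleftrightarrow> u = 0) \<and>
     (\<forall>c u. N (c *\<^sub>R u) = \<bar>c\<bar> * N u) \<and>
     (\<forall>u v. N (u + v) \<le> N u + N v)"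

definition l1_norm :: "real ^ 'n \<Rightarrow> real" where
  "l1_norm x = (\<Sum>i\<in>UNIV. \<bar>x $ i\<bar>)"

text \<open>
  \<open>v\<close> is obtained from \<open>w\<close> by zeroing all but the \<open>s\<close> entries of largest magnitude.
  This is a relation rather than a function since ties may be broken in any way.
  If \<open>s\<close> exceeds the dimension, every entry is kept.
\<close>

definition is_s_truncation :: "nat \<Rightarrow> real ^ 'n \<Rightarrow> real ^ 'n \<Rightarrow> bool" where
  "is_s_truncation s w v \<longleftrightarrow>
     (\<exists>J. card J = min s CARD('n) \<and>
          (\<forall>i\<in>J. \<forall>j\<in>- J. \<bar>w $ j\<bar> \<le> \<bar>w $ i\<bar>) \<and>
          v = (\<chi> i. if i \<in> J then w $ i else 0))"

definition SG_theta ::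
  "(real ^ 'm \<Rightarrow> real) \<Rightarrow> 'n set \<Rightarrow> 'n set \<Rightarrow> nat \<Rightarrow> real \<Rightarrow> real \<Rightarrow> real \<Rightarrow> real ^ 'n ^ 'm \<Rightarrow> bool"
where
  "SG_theta N Pp Pn s \<beta> \<xi> \<theta> A \<longleftrightarrow>
     (\<forall>(x :: real ^ 'n) J. card J \<le> s \<longrightarrow>
        (\<Sum>i\<in>J \<inter> Pp. x $ i) + (\<Sum>i\<in>J \<inter> Pn. \<bar>x $ i\<bar>)
        \<le> \<beta> * N (A *v x) +
           \<xi> * ((\<Sum>i\<in>Pn - J. \<bar>x $ i\<bar>) + (\<Sum>i\<in>Pp - J. max (- (x $ i)) (\<theta> * x $ i))))"

definition SG ::
  "(real ^ 'm \<Rightarrow> real) \<Rightarrow> 'n set \<Rightarrow> 'n set \<Rightarrow> nat \<Rightarrow> real \<Rightarrow> real \<Rightarrow> real ^ 'n ^ 'm \<Rightarrow> bool"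
where
  "SG N Pp Pn s \<beta> \<xi> A \<longleftrightarrow>
     (\<forall>J (x :: real ^ 'n). card J \<le> s \<longrightarrow> (\<forall>i\<in>Pp - J. x $ i \<le> 0) \<longrightarrow>
        (\<Sum>i\<in>J \<inter> Pp. x $ i) + (\<Sum>i\<in>J \<inter> Pn. \<bar>x $ i\<bar>)
        \<le> \<beta> * N (A *v x) + \<xi> * (\<Sum>i\<in>- J. \<bar>x $ i\<bar>))"

definition l1_feasible ::
  "(real ^ 'm \<Rightarrow> real) \<Rightarrow> 'n set \<Rightarrow> real ^ 'n ^ 'm \<Rightarrow> real ^ 'm \<Rightarrow> real \<Rightarrow> (real ^ 'n) set"
where
  "l1_feasible N Pp A y \<epsilon> = {z. N (A *v z - y) \<le> \<epsilon> \<and> (\<forall>i\<in>Pp. 0 \<le> z $ i)}"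

text \<open>
  For a norm \<open>N\<close> and a nonempty feasible set the infimum is a minimum, because the feasible set
  is closed and the objective is continuous and coercive.
\<close>

definition l1_opt ::
  "(real ^ 'm \<Rightarrow> real) \<Rightarrow> 'n set \<Rightarrow> real ^ 'n ^ 'm \<Rightarrow> real ^ 'm \<Rightarrow> real \<Rightarrow> real"
where
  "l1_opt N Pp A y \<epsilon> = (INF z\<in>l1_feasible N Pp A y \<epsilon>. l1_norm z)"

text \<open>
  The residual constraint is relaxed from \<open>\<epsilon>\<close> to \<open>\<delta>\<close> and the objective by \<open>\<nu>\<close>, but the sign
  constraints are kept: without them the error bounds fail, e.g. for
  \<open>A = [1, -1]\<close>, both coordinates sign-constrained, \<open>w = (1, 0)\<close>, \<open>y = 1\<close>, \<open>x = (0, -1)\<close> and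
  \<open>\<mu> = \<nu> = \<epsilon> = \<delta> = 0\<close>, where the conditions hold with \<open>s = \<beta> = 1\<close>, \<open>\<xi> = 1/2\<close>, \<open>\<theta> = 2\<close>.
\<close>

definition l1_approx_solution ::
  "(real ^ 'm \<Rightarrow> real) \<Rightarrow> 'n set \<Rightarrow> real ^ 'n ^ 'm \<Rightarrow> real ^ 'm \<Rightarrow> real \<Rightarrow> real \<Rightarrow> real \<Rightarrow> real ^ 'n \<Rightarrow> bool"
where
  "l1_approx_solution N Pp A y \<epsilon> \<delta> \<nu> x \<longleftrightarrow>
     (\<forall>i\<in>Pp. 0 \<le> x $ i) \<and>
     l1_norm x \<le> l1_opt N Pp A y \<epsilon> + \<nu> \<and>
     N (A *v x - y) \<le> \<delta>"

definition max_column_norm :: "(real ^ 'm \<Rightarrow> real) \<Rightarrow> real ^ 'n ^ 'm \<Rightarrow> real" where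
  "max_column_norm N A = Max (range (\<lambda>j. N (column j A)))"

end

theory Submission
  imports Defs
begin

text \<open>
  Let \<open>J\<close> be the set of coordinates of \<open>w\<close> kept by the truncation and put \<open>d = w - x\<close>. Since
  \<open>w\<close> is feasible, the \<open>\<ell>\<^sub>1\<close>-norm of \<open>x\<close> exceeds that of \<open>w\<close> by at most \<open>\<nu>\<close>. Hence, up to \<open>\<mu> + \<nu>\<close>,
  the mass that \<open>x\<close> carries outside \<open>J\<close> and the mass that it gains over \<open>w\<close> inside \<open>J\<close> have to be
  paid for by coordinates where \<open>x\<close> is smaller than \<open>w\<close> in magnitude.

  The conditions bound a sum in which the sign-constrained coordinates of \<open>J\<close> enter without
  absolute values, so at \<open>J\<close> itself they do not control the whole \<open>\<ell>\<^sub>1\<close>-mass of \<open>d\<close> on \<open>J\<close>. They are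
  therefore applied at the smaller set \<open>K\<close> obtained from \<open>J\<close> by dropping the sign-constrained
  coordinates with \<open>w $ i < x $ i\<close>. On \<open>K\<close> the signed sum is the \<open>\<ell>\<^sub>1\<close>-mass, and at the
  dropped coordinates the growth of \<open>\<bar>x $ i\<bar>\<close> over \<open>\<bar>w $ i\<bar>\<close> equals \<open>\<bar>d $ i\<bar>\<close>.
  With \<open>a = (\<Sum>i\<in>K. \<bar>d $ i\<bar>)\<close> and \<open>R = (\<Sum>i\<in>J - K. \<bar>d $ i\<bar>) + (\<Sum>i\<in>- J. \<bar>x $ i\<bar>)\<close>,
  optimality gives \<open>R \<le> a + \<mu> + \<nu>\<close> (lemma \<open>mass_balance\<close>), while the conditions give
  \<open>a \<le> B + \<xi> * R\<close>. As \<open>\<xi> < 1\<close>, these two inequalities bound \<open>a\<close>, hence \<open>R\<close>, hence the error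
  (lemma \<open>l1_error_bound\<close>).

  The two parts differ only in how \<open>B\<close> is found. In the first, the condition is applied to \<open>d\<close>, and
  the asymmetric penalty \<open>max (- t) (\<theta> * t)\<close> contributes \<open>\<xi> * \<theta> * \<mu>\<close> because at the
  sign-constrained coordinates outside \<open>J\<close> the positive part of \<open>d\<close> is at most \<open>w\<close>. In
  the second, the vector must be nonpositive on the sign-constrained coordinates outside \<open>K\<close>, so
  the tail of \<open>w\<close> is removed and the condition is applied to the truncation minus \<open>x\<close>; the removed tail then reappears in the
  residual, as \<open>\<beta> * max_column_norm N A * \<mu>\<close>.
\<close>

section \<open>Norms and residuals\<close>

lemma is_norm_triangle: "is_norm N \<Longrightarrow> N (u + v) \<le> N u + N v"
  by (simp add: is_norm_def)

lemma is_norm_scaleR: "is_norm N \<Longrightarrow> N (c *\<^sub>R u) = \<bar>c\<bar> * N u"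
  by (simp add: is_norm_def)

lemma is_norm_zero: "is_norm N \<Longrightarrow> N 0 = 0"
  by (simp add: is_norm_def)

lemma is_norm_diff:
  assumes "is_norm N"
  shows "N (u - v) \<le> N u + N v"
  using is_norm_triangle[OF assms, of u "(-1) *\<^sub>R v"] is_norm_scaleR[OF assms, of "-1" v]
  by simp

lemma is_norm_sum:
  assumes "is_norm N" "finite S"
  shows "N (\<Sum>i\<in>S. f i) \<le> (\<Sum>i\<in>S. N (f i))"
  using assms(2)
proof (induction S rule: finite_induct)
  case empty
  then show ?case by (simp add: is_norm_zero[OF assms(1)])
next
  case (insert i S)
  then show ?case
    using is_norm_triangle[OF assms(1), of "f i" "\<Sum>i\<in>S. f i"] by simp
qed

text \<open>
  The operator norm from \<open>\<ell>\<^sub>1\<close> is at most the largest column norm, because the image of \<open>v\<close> is the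
  combination of the columns with coefficients \<open>v $ j\<close>.
\<close>

lemma norm_matrix_vector_le_l1:
  fixes A :: "real ^ 'n ^ 'm"
  assumes "is_norm N"
  shows "N (A *v v) \<le> max_column_norm N A * l1_norm v"
proof -
  have "A *v v = (\<Sum>j\<in>UNIV. (v $ j) *\<^sub>R column j A)"
    by (simp add: matrix_mult_sum scalar_mult_eq_scaleR)
  then have "N (A *v v) \<le> (\<Sum>j\<in>UNIV. N ((v $ j) *\<^sub>R column j A))"
    using is_norm_sum[OF assms, of UNIV "\<lambda>j. (v $ j) *\<^sub>R column j A"] by simp
  also have "\<dots> = (\<Sum>j\<in>UNIV. \<bar>v $ j\<bar> * N (column j A))"
    by (simp add: is_norm_scaleR[OF assms])
  also have "\<dots> \<le> (\<Sum>j\<in>UNIV. \<bar>v $ j\<bar> * max_column_norm N A)"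
    by (intro sum_mono mult_left_mono) (auto simp: max_column_norm_def)
  also have "\<dots> = max_column_norm N A * l1_norm v"
    by (simp add: l1_norm_def sum_distrib_left mult.commute)
  finally show ?thesis .
qed

lemma max_column_norm_nonneg:
  assumes "is_norm N"
  shows "0 \<le> max_column_norm N A"
proof -
  have "0 \<le> N (column undefined A)" using assms by (simp add: is_norm_def)
  also have "\<dots> \<le> max_column_norm N A" by (simp add: max_column_norm_def)
  finally show ?thesis .
qed

lemma residual_diff_le:
  fixes A :: "real ^ 'n ^ 'm"
  assumes "is_norm N" "N (A *v u - y) \<le> \<epsilon>" "N (A *v v - y) \<le> \<delta>"
  shows "N (A *v (u - v)) \<le> \<epsilon> + \<delta>"
  using is_norm_diff[OF assms(1), of "A *v u - y" "A *v v - y"] assms(2,3)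
  by (simp add: matrix_vector_mult_diff_distrib)

section \<open>Comparison of two vectors of nearly equal mass\<close>

lemma l1_opt_le:
  assumes "z \<in> l1_feasible N Pp A y \<epsilon>"
  shows "l1_opt N Pp A y \<epsilon> \<le> l1_norm z"
proof -
  have "bdd_below (l1_norm ` l1_feasible N Pp A y \<epsilon>)"
    by (rule bdd_belowI[of _ 0]) (auto simp: l1_norm_def intro: sum_nonneg)
  then show ?thesis
    unfolding l1_opt_def using assms by (rule cINF_lower)
qed

lemma sum_split_nested:
  fixes f :: "'n::finite \<Rightarrow> real"
  assumes "K \<subseteq> J"
  shows "sum f UNIV = sum f K + sum f (J - K) + sum f (- J)"
  using sum.subset_diff[OF assms, of f] sum.subset_diff[of J UNIV f]
  by (simp add: Compl_eq_Diff_UNIV)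

text \<open>
  Compared with \<open>w\<close>, the magnitudes of the entries of \<open>x\<close> may shrink on \<open>K\<close>, by at most \<open>\<bar>w $ i - x $ i\<bar>\<close> each; on
  \<open>J - K\<close> they grow by exactly the size of the error. So this is the bound on the mass of \<open>x\<close>,
  sorted by coordinates.
\<close>

lemma mass_balance:
  fixes w x :: "real ^ 'n"
  assumes "K \<subseteq> J"
    and grow: "\<And>i. i \<in> J - K \<Longrightarrow> \<bar>x $ i\<bar> = \<bar>w $ i\<bar> + \<bar>w $ i - x $ i\<bar>"
    and mass: "l1_norm x \<le> l1_norm w + \<nu>"
  shows "(\<Sum>i\<in>J - K. \<bar>w $ i - x $ i\<bar>) + (\<Sum>i\<in>- J. \<bar>x $ i\<bar>)
         \<le> (\<Sum>i\<in>K. \<bar>w $ i - x $ i\<bar>) + (\<Sum>i\<in>- J. \<bar>w $ i\<bar>) + \<nu>"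
proof -
  have "(\<Sum>i\<in>J - K. \<bar>x $ i\<bar>) = (\<Sum>i\<in>J - K. \<bar>w $ i\<bar>) + (\<Sum>i\<in>J - K. \<bar>w $ i - x $ i\<bar>)"
    using grow by (simp add: sum.distrib[symmetric])
  moreover have "(\<Sum>i\<in>K. \<bar>w $ i\<bar>) \<le> (\<Sum>i\<in>K. \<bar>x $ i\<bar>) + (\<Sum>i\<in>K. \<bar>w $ i - x $ i\<bar>)"
    unfolding sum.distrib[symmetric] by (rule sum_mono) linarith
  ultimately show ?thesis
    using mass sum_split_nested[OF assms(1), of "\<lambda>i. \<bar>x $ i\<bar>"]
      sum_split_nested[OF assms(1), of "\<lambda>i. \<bar>w $ i\<bar>"]
    unfolding l1_norm_def by linarith
qed

text \<open>
  With \<open>a\<close> for the error on \<open>K\<close> and \<open>R\<close> for the bracket in \<open>bound\<close>, \<open>mass_balance\<close> reads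
  \<open>R \<le> a + \<mu> + \<nu>\<close>. Inserting it into \<open>bound\<close> gives \<open>(1 - \<xi>) * a \<le> B + \<xi> * (\<mu> + \<nu>)\<close>, and the total
  error is at most \<open>a + R + \<mu> \<le> 2 * a + 2 * \<mu> + \<nu>\<close>.
\<close>

lemma l1_error_bound:
  fixes w x :: "real ^ 'n"
  assumes "K \<subseteq> J"
    and grow: "\<And>i. i \<in> J - K \<Longrightarrow> \<bar>x $ i\<bar> = \<bar>w $ i\<bar> + \<bar>w $ i - x $ i\<bar>"
    and mass: "l1_norm x \<le> l1_norm w + \<nu>"
    and tail: "(\<Sum>i\<in>- J. \<bar>w $ i\<bar>) \<le> \<mu>"
    and \<xi>: "0 \<le> \<xi>" "\<xi> < 1"
    and bound: "(\<Sum>i\<in>K. \<bar>w $ i - x $ i\<bar>)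
                \<le> B + \<xi> * ((\<Sum>i\<in>J - K. \<bar>w $ i - x $ i\<bar>) + (\<Sum>i\<in>- J. \<bar>x $ i\<bar>))"
  shows "l1_norm (x - w) \<le> ((1 + \<xi>) * \<nu> + 2 * \<mu> + 2 * B) / (1 - \<xi>)"
proof -
  define a where "a = (\<Sum>i\<in>K. \<bar>w $ i - x $ i\<bar>)"
  define R where "R = (\<Sum>i\<in>J - K. \<bar>w $ i - x $ i\<bar>) + (\<Sum>i\<in>- J. \<bar>x $ i\<bar>)"
  have R: "R \<le> a + \<mu> + \<nu>"
    using mass_balance[OF assms(1) grow mass] tail by (simp add: a_def R_def)
  have "a \<le> B + \<xi> * R" using bound by (simp add: a_def R_def)
  also have "\<dots> \<le> B + \<xi> * (a + \<mu> + \<nu>)"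
    using R \<xi>(1) by (simp add: mult_left_mono)
  finally have a: "(1 - \<xi>) * a \<le> B + \<xi> * (\<mu> + \<nu>)" by (simp add: algebra_simps)
  have "(\<Sum>i\<in>- J. \<bar>w $ i - x $ i\<bar>) \<le> (\<Sum>i\<in>- J. \<bar>x $ i\<bar>) + (\<Sum>i\<in>- J. \<bar>w $ i\<bar>)"
    unfolding sum.distrib[symmetric] by (rule sum_mono) linarith
  moreover have "l1_norm (x - w) = (\<Sum>i\<in>UNIV. \<bar>w $ i - x $ i\<bar>)"
    by (simp add: l1_norm_def abs_minus_commute)
  ultimately have "l1_norm (x - w) \<le> a + R + \<mu>"
    using tail sum_split_nested[OF assms(1), of "\<lambda>i. \<bar>w $ i - x $ i\<bar>"]
    by (simp add: a_def R_def)
  then have "l1_norm (x - w) \<le> 2 * a + 2 * \<mu> + \<nu>" using R by linarith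
  then have "(1 - \<xi>) * l1_norm (x - w) \<le> (1 - \<xi>) * (2 * a + 2 * \<mu> + \<nu>)"
    using \<xi>(2) by (intro mult_left_mono) auto
  also have "\<dots> \<le> (1 + \<xi>) * \<nu> + 2 * \<mu> + 2 * B"
    using a by (simp add: algebra_simps)
  finally show ?thesis using \<xi>(2) by (simp add: pos_le_divide_eq mult.commute)
qed

section \<open>The bounds supplied by the two conditions\<close>

text \<open>
  This is what turns the conditions, which control only a signed sum, into bounds on an error: it
  replaces their left-hand side once the coordinates of the wrong sign have been dropped.
\<close>

lemma signed_sum_eq_l1_mass:
  fixes d :: "real ^ 'n"
  assumes "Pp \<union> Pn = UNIV" "Pp \<inter> Pn = {}"
    and "\<And>i. i \<in> K \<inter> Pp \<Longrightarrow> 0 \<le> d $ i"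
  shows "(\<Sum>i\<in>K \<inter> Pp. d $ i) + (\<Sum>i\<in>K \<inter> Pn. \<bar>d $ i\<bar>) = (\<Sum>i\<in>K. \<bar>d $ i\<bar>)"
proof -
  have "K = (K \<inter> Pp) \<union> (K \<inter> Pn)" using assms(1) by blast
  moreover have "(K \<inter> Pp) \<inter> (K \<inter> Pn) = {}" using assms(2) by blast
  ultimately have "(\<Sum>i\<in>K. \<bar>d $ i\<bar>) = (\<Sum>i\<in>K \<inter> Pp. \<bar>d $ i\<bar>) + (\<Sum>i\<in>K \<inter> Pn. \<bar>d $ i\<bar>)"
    by (metis finite sum.union_disjoint)
  then show ?thesis using assms(3) by simp
qed

text \<open>
  On \<open>J - K\<close> the difference is nonpositive at sign-constrained coordinates, so its penalty is its
  absolute value. Outside \<open>J\<close>, \<open>x\<close> is charged with weight \<open>1\<close> and \<open>w\<close> with weight \<open>\<theta>\<close>: at a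
  sign-constrained coordinate the difference \<open>w $ i - x $ i\<close> has penalty at most \<open>x $ i\<close> when it is
  negative, and at most \<open>\<theta> * w $ i\<close> otherwise.
\<close>

lemma SG_theta_mass_bound:
  fixes w x :: "real ^ 'n"
  assumes SG: "SG_theta N Pp Pn s \<beta> \<xi> \<theta> A"
    and P: "Pp \<union> Pn = UNIV" "Pp \<inter> Pn = {}"
    and nonneg: "\<And>i. i \<in> Pp \<Longrightarrow> 0 \<le> w $ i" "\<And>i. i \<in> Pp \<Longrightarrow> 0 \<le> x $ i"
    and K: "K \<subseteq> J" "card K \<le> s"
      "\<And>i. i \<in> K \<inter> Pp \<Longrightarrow> x $ i \<le> w $ i" "\<And>i. i \<in> (J - K) \<inter> Pp \<Longrightarrow> w $ i \<le> x $ i"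
    and par: "0 \<le> \<beta>" "0 \<le> \<xi>" "1 \<le> \<theta>"
    and tail: "(\<Sum>i\<in>- J. \<bar>w $ i\<bar>) \<le> \<mu>"
    and res: "N (A *v (w - x)) \<le> \<rho>"
  shows "(\<Sum>i\<in>K. \<bar>w $ i - x $ i\<bar>)
         \<le> (\<beta> * \<rho> + \<xi> * \<theta> * \<mu>)
            + \<xi> * ((\<Sum>i\<in>J - K. \<bar>w $ i - x $ i\<bar>) + (\<Sum>i\<in>- J. \<bar>x $ i\<bar>))"
proof -
  define d where "d = w - x"
  define g where "g i = (if i \<in> Pp then max (- (d $ i)) (\<theta> * d $ i) else \<bar>d $ i\<bar>)" for i
  let ?R = "(\<Sum>i\<in>J - K. \<bar>w $ i - x $ i\<bar>) + (\<Sum>i\<in>- J. \<bar>x $ i\<bar>)"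
  have \<theta>w: "\<bar>w $ i\<bar> \<le> \<theta> * \<bar>w $ i\<bar>" for i
    using par(3) mult_right_mono[of 1 \<theta> "\<bar>w $ i\<bar>"] by simp
  have "g i \<le> \<bar>w $ i - x $ i\<bar>" if "i \<in> J - K" for i
  proof (cases "i \<in> Pp")
    case True
    then have "w $ i \<le> x $ i" using K(4) that by blast
    moreover from this have "\<theta> * (w $ i - x $ i) \<le> 0"
      using par(3) by (intro mult_nonneg_nonpos) auto
    ultimately show ?thesis using True by (simp add: g_def d_def)
  qed (simp add: g_def d_def)
  then have gJ: "sum g (J - K) \<le> (\<Sum>i\<in>J - K. \<bar>w $ i - x $ i\<bar>)"
    by (intro sum_mono)
  have g_off: "g i \<le> \<bar>x $ i\<bar> + \<theta> * \<bar>w $ i\<bar>" for i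
  proof (cases "i \<in> Pp")
    case True
    have "\<theta> * (w $ i - x $ i) \<le> \<theta> * \<bar>w $ i\<bar>"
      using par(3) nonneg[OF True] by (intro mult_left_mono) auto
    then show ?thesis
      using True nonneg[OF True] \<theta>w[of i] by (simp add: g_def d_def)
  next
    case False
    then show ?thesis using \<theta>w[of i] by (simp add: g_def d_def)
  qed
  have "sum g (- J) \<le> (\<Sum>i\<in>- J. \<bar>x $ i\<bar> + \<theta> * \<bar>w $ i\<bar>)"
    by (rule sum_mono) (rule g_off)
  also have "\<dots> = (\<Sum>i\<in>- J. \<bar>x $ i\<bar>) + \<theta> * (\<Sum>i\<in>- J. \<bar>w $ i\<bar>)"
    by (simp add: sum.distrib sum_distrib_left)
  also have "\<dots> \<le> (\<Sum>i\<in>- J. \<bar>x $ i\<bar>) + \<theta> * \<mu>"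
    using tail par(3) by (simp add: mult_left_mono)
  finally have g: "sum g (J - K) + sum g (- J) \<le> ?R + \<theta> * \<mu>" using gJ by linarith
  have split: "(J - K) \<union> - J = (Pn - K) \<union> (Pp - K)" using K(1) P(1) by blast
  have "sum g (J - K) + sum g (- J) = sum g ((J - K) \<union> - J)"
    by (rule sum.union_disjoint[symmetric]) auto
  also have "\<dots> = sum g (Pn - K) + sum g (Pp - K)"
    unfolding split by (rule sum.union_disjoint) (use P(2) in auto)
  also have "sum g (Pn - K) = (\<Sum>i\<in>Pn - K. \<bar>d $ i\<bar>)"
    using P(2) by (intro sum.cong) (auto simp: g_def)
  also have "sum g (Pp - K) = (\<Sum>i\<in>Pp - K. max (- (d $ i)) (\<theta> * d $ i))"
    by (intro sum.cong) (auto simp: g_def)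
  finally have penalty: "(\<Sum>i\<in>Pn - K. \<bar>d $ i\<bar>) + (\<Sum>i\<in>Pp - K. max (- (d $ i)) (\<theta> * d $ i))
      \<le> ?R + \<theta> * \<mu>" using g by simp
  have "(\<Sum>i\<in>K. \<bar>w $ i - x $ i\<bar>) = (\<Sum>i\<in>K \<inter> Pp. d $ i) + (\<Sum>i\<in>K \<inter> Pn. \<bar>d $ i\<bar>)"
    using signed_sum_eq_l1_mass[OF P, of K d] K(3) by (simp add: d_def)
  also have "\<dots> \<le> \<beta> * N (A *v d) + \<xi> * ((\<Sum>i\<in>Pn - K. \<bar>d $ i\<bar>)
                     + (\<Sum>i\<in>Pp - K. max (- (d $ i)) (\<theta> * d $ i)))"
    using SG K(2) unfolding SG_theta_def by blast
  also have "\<dots> \<le> \<beta> * \<rho> + \<xi> * (?R + \<theta> * \<mu>)"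
    using mult_left_mono[OF res par(1)] mult_left_mono[OF penalty par(2)]
    unfolding d_def by linarith
  finally show ?thesis by (simp add: algebra_simps)
qed

text \<open>
  Outside \<open>J\<close>, where \<open>w\<close> may exceed \<open>x\<close>, the vector \<open>w - x\<close> can violate the sign requirement of the
  condition. With \<open>v\<close> in place of \<open>w\<close> it becomes \<open>- x\<close> there, which satisfies it, and it is
  unchanged on \<open>J\<close>.
\<close>

lemma SG_mass_bound:
  fixes w x :: "real ^ 'n"
  assumes SG: "SG N Pp Pn s \<beta> \<xi> A"
    and P: "Pp \<union> Pn = UNIV" "Pp \<inter> Pn = {}"
    and nonneg: "\<And>i. i \<in> Pp \<Longrightarrow> 0 \<le> x $ i"
    and K: "K \<subseteq> J" "card K \<le> s"
      "\<And>i. i \<in> K \<inter> Pp \<Longrightarrow> x $ i \<le> w $ i" "\<And>i. i \<in> (J - K) \<inter> Pp \<Longrightarrow> w $ i \<le> x $ i"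
    and v: "v = (\<chi> i. if i \<in> J then w $ i else 0)"
    and \<beta>: "0 \<le> \<beta>"
    and res: "N (A *v (v - x)) \<le> \<rho>"
  shows "(\<Sum>i\<in>K. \<bar>w $ i - x $ i\<bar>)
         \<le> \<beta> * \<rho> + \<xi> * ((\<Sum>i\<in>J - K. \<bar>w $ i - x $ i\<bar>) + (\<Sum>i\<in>- J. \<bar>x $ i\<bar>))"
proof -
  define d where "d = v - x"
  have d: "d $ i = (if i \<in> J then w $ i - x $ i else - x $ i)" for i
    by (simp add: d_def v)
  have dK: "d $ i = w $ i - x $ i" if "i \<in> K" for i using d that K(1) by auto
  have neg: "\<forall>i\<in>Pp - K. d $ i \<le> 0" using d nonneg K(4) by auto
  have "(\<Sum>i\<in>K. \<bar>w $ i - x $ i\<bar>) = (\<Sum>i\<in>K. \<bar>d $ i\<bar>)" by (simp add: dK)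
  also have "\<dots> = (\<Sum>i\<in>K \<inter> Pp. d $ i) + (\<Sum>i\<in>K \<inter> Pn. \<bar>d $ i\<bar>)"
    using signed_sum_eq_l1_mass[OF P, of K d] K(3) dK by simp
  also have "\<dots> \<le> \<beta> * N (A *v d) + \<xi> * (\<Sum>i\<in>- K. \<bar>d $ i\<bar>)"
    using SG K(2) neg unfolding SG_def by blast
  also have "\<dots> \<le> \<beta> * \<rho> + \<xi> * (\<Sum>i\<in>- K. \<bar>d $ i\<bar>)"
    using res \<beta> by (simp add: d_def mult_left_mono)
  also have "- K = (J - K) \<union> - J" using K(1) by blast
  also have "(\<Sum>i\<in>(J - K) \<union> - J. \<bar>d $ i\<bar>)
      = (\<Sum>i\<in>J - K. \<bar>d $ i\<bar>) + (\<Sum>i\<in>- J. \<bar>d $ i\<bar>)"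
    by (rule sum.union_disjoint) auto
  also have "\<dots> = (\<Sum>i\<in>J - K. \<bar>w $ i - x $ i\<bar>) + (\<Sum>i\<in>- J. \<bar>x $ i\<bar>)"
    by (simp add: d)
  finally show ?thesis .
qed

section \<open>The error bounds\<close>

theorem proposition3p1:
  fixes A :: "real ^ 'n ^ 'm"
    and N :: "real ^ 'm \<Rightarrow> real"
    and Pp Pn :: "'n set"
    and s :: nat
    and w ws x :: "real ^ 'n"
    and y :: "real ^ 'm"
    and \<mu> \<nu> \<epsilon> \<delta> :: real
  assumes "is_norm N"
    and "1 \<le> s" and "s \<le> CARD('m)"
    and "Pp \<union> Pn = UNIV" and "Pp \<inter> Pn = {}"
    and "\<forall>i\<in>Pp. 0 \<le> w $ i"
    and "is_s_truncation s w ws"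
    and "l1_norm (w - ws) \<le> \<mu>"
    and "N (A *v w - y) \<le> \<epsilon>"
    and "l1_approx_solution N Pp A y \<epsilon> \<delta> \<nu> x"
  shows "(\<forall>\<xi> \<beta> \<theta>. 0 < \<xi> \<and> \<xi> < 1 \<and> 0 \<le> \<beta> \<and> 1 \<le> \<theta> \<and> SG_theta N Pp Pn s \<beta> \<xi> \<theta> A \<longrightarrow>
            l1_norm (x - w) \<le> (1 + \<xi>) / (1 - \<xi>) * \<nu>
                              + 2 * (1 + \<xi> * \<theta>) / (1 - \<xi>) * \<mu>
                              + 2 * \<beta> / (1 - \<xi>) * (\<epsilon> + \<delta>))
       \<and> (\<forall>\<xi> \<beta>. 0 < \<xi> \<and> \<xi> < 1 \<and> 0 \<le> \<beta> \<and> SG N Pp Pn s \<beta> \<xi> A \<longrightarrow>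
            l1_norm (x - w) \<le> (1 + \<xi>) / (1 - \<xi>) * \<nu>
                              + 2 * (1 + \<beta> * max_column_norm N A) / (1 - \<xi>) * \<mu>
                              + 2 * \<beta> / (1 - \<xi>) * (\<epsilon> + \<delta>))"
proof -
  note N = \<open>is_norm N\<close>
  note P = \<open>Pp \<union> Pn = UNIV\<close> \<open>Pp \<inter> Pn = {}\<close>
  have w: "\<And>i. i \<in> Pp \<Longrightarrow> 0 \<le> w $ i" using \<open>\<forall>i\<in>Pp. 0 \<le> w $ i\<close> by blast
  have x: "\<And>i. i \<in> Pp \<Longrightarrow> 0 \<le> x $ i" and opt: "l1_norm x \<le> l1_opt N Pp A y \<epsilon> + \<nu>"
    and resx: "N (A *v x - y) \<le> \<delta>"
    using \<open>l1_approx_solution N Pp A y \<epsilon> \<delta> \<nu> x\<close> by (auto simp: l1_approx_solution_def)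
  have "w \<in> l1_feasible N Pp A y \<epsilon>"
    using w \<open>N (A *v w - y) \<le> \<epsilon>\<close> by (simp add: l1_feasible_def)
  then have mass: "l1_norm x \<le> l1_norm w + \<nu>" using opt l1_opt_le by fastforce
  obtain J where cardJ: "card J = min s CARD('n)"
    and ws: "ws = (\<chi> i. if i \<in> J then w $ i else 0)"
    using \<open>is_s_truncation s w ws\<close> unfolding is_s_truncation_def by blast
  from cardJ have J: "card J \<le> s" by simp
  have "l1_norm (w - ws) = (\<Sum>i\<in>UNIV. if i \<in> - J then \<bar>w $ i\<bar> else 0)"
    unfolding l1_norm_def by (rule sum.cong) (auto simp: ws)
  also have "\<dots> = (\<Sum>i\<in>- J. \<bar>w $ i\<bar>)" by (simp add: sum.If_cases Compl_eq)
  finally have tail: "(\<Sum>i\<in>- J. \<bar>w $ i\<bar>) \<le> \<mu>" using \<open>l1_norm (w - ws) \<le> \<mu>\<close> by simp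
  define K where "K = {i \<in> J. i \<in> Pp \<longrightarrow> x $ i \<le> w $ i}"
  have K: "K \<subseteq> J" "\<And>i. i \<in> K \<inter> Pp \<Longrightarrow> x $ i \<le> w $ i"
    "\<And>i. i \<in> (J - K) \<inter> Pp \<Longrightarrow> w $ i \<le> x $ i" by (auto simp: K_def)
  have cardK: "card K \<le> s" using J card_mono[OF _ K(1)] by simp
  have grow: "\<bar>x $ i\<bar> = \<bar>w $ i\<bar> + \<bar>w $ i - x $ i\<bar>" if "i \<in> J - K" for i
    using that w[of i] x[of i] by (auto simp: K_def)
  have res: "N (A *v (w - x)) \<le> \<epsilon> + \<delta>"
    using residual_diff_le[OF N \<open>N (A *v w - y) \<le> \<epsilon>\<close> resx] .
  let ?\<alpha> = "max_column_norm N A"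
  have "N (A *v (w - ws)) \<le> ?\<alpha> * l1_norm (w - ws)"
    by (rule norm_matrix_vector_le_l1[OF N])
  also have "\<dots> \<le> ?\<alpha> * \<mu>"
    using \<open>l1_norm (w - ws) \<le> \<mu>\<close> max_column_norm_nonneg[OF N] by (rule mult_left_mono)
  finally have "N (A *v (w - x) - A *v (w - ws)) \<le> \<epsilon> + \<delta> + ?\<alpha> * \<mu>"
    using is_norm_diff[OF N, of "A *v (w - x)" "A *v (w - ws)"] res by linarith
  then have res': "N (A *v (ws - x)) \<le> \<epsilon> + \<delta> + ?\<alpha> * \<mu>"
    by (simp add: matrix_vector_mult_diff_distrib)
  let ?a = "\<Sum>i\<in>K. \<bar>w $ i - x $ i\<bar>"
  let ?R = "(\<Sum>i\<in>J - K. \<bar>w $ i - x $ i\<bar>) + (\<Sum>i\<in>- J. \<bar>x $ i\<bar>)"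
  show ?thesis
  proof (intro conjI allI impI; elim conjE)
    fix \<xi> \<beta> \<theta> :: real
    assume par: "0 < \<xi>" "\<xi> < 1" "0 \<le> \<beta>" "1 \<le> \<theta>" and SG: "SG_theta N Pp Pn s \<beta> \<xi> \<theta> A"
    have bound: "?a \<le> (\<beta> * (\<epsilon> + \<delta>) + \<xi> * \<theta> * \<mu>) + \<xi> * ?R"
      by (rule SG_theta_mass_bound[OF SG P _ _ K(1) cardK _ _ par(3) _ par(4) tail res])
        (use w x K(2,3) par(1) in auto)
    have "l1_norm (x - w)
        \<le> ((1 + \<xi>) * \<nu> + 2 * \<mu> + 2 * (\<beta> * (\<epsilon> + \<delta>) + \<xi> * \<theta> * \<mu>)) / (1 - \<xi>)"
      by (rule l1_error_bound[OF K(1) _ mass tail _ par(2) bound]) (use grow par(1) in simp_all)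
    also have "\<dots> = (1 + \<xi>) / (1 - \<xi>) * \<nu> + 2 * (1 + \<xi> * \<theta>) / (1 - \<xi>) * \<mu>
        + 2 * \<beta> / (1 - \<xi>) * (\<epsilon> + \<delta>)"
      by (simp add: add_divide_distrib[symmetric] algebra_simps)
    finally show "l1_norm (x - w) \<le> (1 + \<xi>) / (1 - \<xi>) * \<nu>
        + 2 * (1 + \<xi> * \<theta>) / (1 - \<xi>) * \<mu> + 2 * \<beta> / (1 - \<xi>) * (\<epsilon> + \<delta>)" .
  next
    fix \<xi> \<beta> :: real
    assume par: "0 < \<xi>" "\<xi> < 1" "0 \<le> \<beta>" and SG: "SG N Pp Pn s \<beta> \<xi> A"
    have bound: "?a \<le> \<beta> * (\<epsilon> + \<delta> + ?\<alpha> * \<mu>) + \<xi> * ?R"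
      by (rule SG_mass_bound[OF SG P _ K(1) cardK _ _ ws par(3) res'])
        (use x K(2,3) in auto)
    have "l1_norm (x - w)
        \<le> ((1 + \<xi>) * \<nu> + 2 * \<mu> + 2 * (\<beta> * (\<epsilon> + \<delta> + ?\<alpha> * \<mu>))) / (1 - \<xi>)"
      by (rule l1_error_bound[OF K(1) _ mass tail _ par(2) bound]) (use grow par(1) in simp_all)
    also have "\<dots> = (1 + \<xi>) / (1 - \<xi>) * \<nu> + 2 * (1 + \<beta> * ?\<alpha>) / (1 - \<xi>) * \<mu>
        + 2 * \<beta> / (1 - \<xi>) * (\<epsilon> + \<delta>)"
      by (simp add: add_divide_distrib[symmetric] algebra_simps)
    finally show "l1_norm (x - w) \<le> (1 + \<xi>) / (1 - \<xi>) * \<nu>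
        + 2 * (1 + \<beta> * ?\<alpha>) / (1 - \<xi>) * \<mu> + 2 * \<beta> / (1 - \<xi>) * (\<epsilon> + \<delta>)" .
  qed
qed

end
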